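(* Let $p^\star=\sum_{\ell=1}^m\pi_\ell^\star\phi(\cdot\mid\mu_\ell^\star)$ satisfy the standing assumptions (A1)–(A3) of the context. Let $\pi\in\Delta^{n-1}$ have strictly positive entries and let $\widetilde\mu\in\mathbb R^{nd}$ be such that $\theta^\star=(\widetilde\mu,\pi)$ induces an exact clustering with partition $[n]=\bigsqcup_{\ell=1}^mS_\ell$, i.e. $\widetilde\mu_i=\mu^\star_\ell$ for all $i\in S_\ell$ and $\sum_{i\in S_\ell}\pi_i=\pi^\star_\ell$ for all $\ell\in[m]$. Define $\mathsf{Avg}:\mathbb R^{dn}\to\mathbb R^{dm}$ by $\mathsf{Avg}_\ell(u)=\sum_{i\in S_\ell}\pi_iu_i$ for $\ell\in[m]$. Then $$\ker\bigl(\nabla^2_{\mu\mu}\mathcal L(\theta^\star)\bigr)=\ker(\mathsf{Avg}).$$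
   Context: $\phi(x\mid\mu)=(2\pi)^{-d/2}e^{-\|x-\mu\|^2/2}$ on $\mathbb R^d$; $\Delta^{k-1}$ is the probability simplex in $\mathbb R^k$; $[n]=\{1,\dots,n\}$. Teacher weights $\pi^\star\in\Delta^{m-1}$ are positive. For $\mu=(\mu_1,\dots,\mu_n)\in\mathbb R^{nd}$ and $\pi\in\Delta^{n-1}$, $p_{\mu,\pi}=\sum_{i=1}^n\pi_i\phi(\cdot\mid\mu_i)$ and $\mathcal L(\mu,\pi)=\mathbb E_{X\sim p^\star}[\log(p^\star(X)/p_{\mu,\pi}(X))]$; $\nabla^2_{\mu\mu}$ is the Hessian in $\mu$ for fixed $\pi$. Standing assumptions on the teacher: (A1) $M^\star=\sum_{\ell}\pi^\star_\ell\mu_\ell^\star{\mu_\ell^\star}^{\top}$ has exactly $m$ nonzero eigenvalues, the largest being $\lambda_{\max}$ and the smallest $\lambda_{\min}>0$. (A2) $D_{\max}\ge\|\mu_\ell^\star\|\ge D_{\min}\ge 4\frac{\lambda_{\max}}{\lambda_{\min}}\sqrt{dn}$ for all $\ell$. (A3) With $\pi^\star_{\min}=\min_\ell\pi^\star_\ell$, $\min_{i\ne j}\|\mu_i^\star-\mu_j^\star\|\ge C_0\max\{\sqrt{D_{\max}}(dn)^{1/4},\sqrt{d/\pi^\star_{\min}},\sqrt{\log(D_{\max}dnm/(\lambda_{\min}\pi^\star_{\min}))}\}$ for a sufficiently large absolute constant $C_0>0$. *)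

theory Defs
  imports "HOL-Probability.Probability" "Jordan_Normal_Form.Char_Poly"
begin

text \<open>
  The constant in the separation assumption is uniform over all dimensions, so dimensions are
  natural numbers rather than types: a vector of \<open>\<real>\<^sup>d\<close> is an extensional function on \<open>{..<d}\<close>, which
  makes \<open>\<real>\<^sup>d\<close> the space of the product measure \<open>lborel_n d\<close>, and a \<open>k\<close>-tuple of such vectors is an
  extensional function on \<open>{..<k}\<close>.  Indices start at \<open>0\<close>.
\<close>

abbreviation lborel_n :: "nat \<Rightarrow> (nat \<Rightarrow> real) measure" where
  "lborel_n d \<equiv> Pi\<^sub>M {..<d} (\<lambda>_. lborel)"

definition configs :: "nat \<Rightarrow> nat \<Rightarrow> (nat \<Rightarrow> nat \<Rightarrow> real) set" where
  "configs k d = {..<k} \<rightarrow>\<^sub>E ({..<d} \<rightarrow>\<^sub>E UNIV)"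

definition prob_simplex :: "nat \<Rightarrow> (nat \<Rightarrow> real) set" where
  "prob_simplex k = {p \<in> {..<k} \<rightarrow>\<^sub>E {0..}. (\<Sum>i<k. p i) = 1}"

definition dist_n :: "nat \<Rightarrow> (nat \<Rightarrow> real) \<Rightarrow> (nat \<Rightarrow> real) \<Rightarrow> real" where
  "dist_n d x y = L2_set (\<lambda>a. x a - y a) {..<d}"

definition gauss :: "nat \<Rightarrow> (nat \<Rightarrow> real) \<Rightarrow> (nat \<Rightarrow> real) \<Rightarrow> real" where
  "gauss d \<mu> x = (2 * pi) powr (- real d / 2) * exp (- (dist_n d x \<mu>)\<^sup>2 / 2)"

definition mixture ::
  "nat \<Rightarrow> nat \<Rightarrow> (nat \<Rightarrow> nat \<Rightarrow> real) \<Rightarrow> (nat \<Rightarrow> real) \<Rightarrow> (nat \<Rightarrow> real) \<Rightarrow> real" where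
  "mixture d k \<mu> w x = (\<Sum>i<k. w i * gauss d (\<mu> i) x)"

definition loss ::
  "nat \<Rightarrow> nat \<Rightarrow> ((nat \<Rightarrow> real) \<Rightarrow> real) \<Rightarrow> (nat \<Rightarrow> nat \<Rightarrow> real) \<Rightarrow> (nat \<Rightarrow> real) \<Rightarrow> real" where
  "loss d n pstar \<mu> w =
     (\<integral>x. ln (pstar x / mixture d n \<mu> w x) \<partial>density (lborel_n d) (\<lambda>x. ennreal (pstar x)))"

definition partial ::
  "nat \<times> nat \<Rightarrow> ((nat \<Rightarrow> nat \<Rightarrow> real) \<Rightarrow> real) \<Rightarrow> (nat \<Rightarrow> nat \<Rightarrow> real) \<Rightarrow> real" where
  "partial = (\<lambda>(i, a) f \<mu>. deriv (\<lambda>t. f (\<mu>(i := (\<mu> i)(a := t)))) (\<mu> i a))"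

definition hessian ::
  "((nat \<Rightarrow> nat \<Rightarrow> real) \<Rightarrow> real) \<Rightarrow> (nat \<Rightarrow> nat \<Rightarrow> real) \<Rightarrow> nat \<times> nat \<Rightarrow> nat \<times> nat \<Rightarrow> real" where
  "hessian f \<mu> r s = partial r (partial s f) \<mu>"

definition hessian_map ::
  "nat \<Rightarrow> nat \<Rightarrow> ((nat \<Rightarrow> nat \<Rightarrow> real) \<Rightarrow> real) \<Rightarrow> (nat \<Rightarrow> nat \<Rightarrow> real) \<Rightarrow>
    (nat \<Rightarrow> nat \<Rightarrow> real) \<Rightarrow> (nat \<Rightarrow> nat \<Rightarrow> real)" where
  "hessian_map n d f \<mu> u =
     (\<lambda>i\<in>{..<n}. \<lambda>a\<in>{..<d}. \<Sum>j<n. \<Sum>b<d. hessian f \<mu> (i, a) (j, b) * u j b)"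

definition avg_map ::
  "nat \<Rightarrow> nat \<Rightarrow> (nat \<Rightarrow> nat set) \<Rightarrow> (nat \<Rightarrow> real) \<Rightarrow>
    (nat \<Rightarrow> nat \<Rightarrow> real) \<Rightarrow> (nat \<Rightarrow> nat \<Rightarrow> real)" where
  "avg_map m d S w u = (\<lambda>l\<in>{..<m}. \<lambda>a\<in>{..<d}. \<Sum>i\<in>S l. w i * u i a)"

definition ker_map ::
  "nat \<Rightarrow> nat \<Rightarrow> nat \<Rightarrow> ((nat \<Rightarrow> nat \<Rightarrow> real) \<Rightarrow> (nat \<Rightarrow> nat \<Rightarrow> real)) \<Rightarrow> (nat \<Rightarrow> nat \<Rightarrow> real) set" where
  "ker_map n k d T = {u \<in> configs n d. T u = (\<lambda>i\<in>{..<k}. \<lambda>a\<in>{..<d}. 0)}"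

definition exact_clustering ::
  "nat \<Rightarrow> nat \<Rightarrow> (nat \<Rightarrow> nat \<Rightarrow> real) \<Rightarrow> (nat \<Rightarrow> real) \<Rightarrow> (nat \<Rightarrow> nat set) \<Rightarrow>
    (nat \<Rightarrow> nat \<Rightarrow> real) \<Rightarrow> (nat \<Rightarrow> real) \<Rightarrow> bool" where
  "exact_clustering n m \<mu>s ws S \<mu> w \<longleftrightarrow>
     (\<Union>l<m. S l) = {..<n} \<and> disjoint_family_on S {..<m} \<and>
     (\<forall>l<m. (\<forall>i\<in>S l. \<mu> i = \<mu>s l) \<and> (\<Sum>i\<in>S l. w i) = ws l)"

definition second_moment :: "nat \<Rightarrow> nat \<Rightarrow> (nat \<Rightarrow> nat \<Rightarrow> real) \<Rightarrow> (nat \<Rightarrow> real) \<Rightarrow> real mat" where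
  "second_moment d m \<mu>s ws = Matrix.mat d d (\<lambda>(a, b). \<Sum>l<m. ws l * (\<mu>s l a * \<mu>s l b))"

text \<open>Eigenvalues are counted with multiplicity, as roots of the characteristic polynomial.\<close>

definition nonzero_eigenvalues :: "real mat \<Rightarrow> real multiset" where
  "nonzero_eigenvalues A = filter_mset (\<lambda>x. x \<noteq> 0) (proots (char_poly A))"

definition spectrum_assm ::
  "nat \<Rightarrow> nat \<Rightarrow> (nat \<Rightarrow> nat \<Rightarrow> real) \<Rightarrow> (nat \<Rightarrow> real) \<Rightarrow> real \<Rightarrow> real \<Rightarrow> bool" where
  "spectrum_assm d m \<mu>s ws lmax lmin \<longleftrightarrow>
     (let E = nonzero_eigenvalues (second_moment d m \<mu>s ws) in
       size E = m \<and> lmax = Max (set_mset E) \<and> lmin = Min (set_mset E) \<and> lmin > 0)"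

definition norm_assm ::
  "nat \<Rightarrow> nat \<Rightarrow> nat \<Rightarrow> (nat \<Rightarrow> nat \<Rightarrow> real) \<Rightarrow> real \<Rightarrow> real \<Rightarrow> real \<Rightarrow> real \<Rightarrow> bool" where
  "norm_assm d n m \<mu>s lmax lmin Dmax Dmin \<longleftrightarrow>
     (\<forall>l<m. Dmin \<le> L2_set (\<mu>s l) {..<d} \<and> L2_set (\<mu>s l) {..<d} \<le> Dmax) \<and>
     Dmin \<ge> 4 * (lmax / lmin) * sqrt (real d * real n)"

text \<open>
  If the argument of \<open>ln\<close> is below \<open>1\<close>, the last entry of the maximum is at most \<open>0\<close>
  (\<open>sqrt\<close> is odd), hence inactive.
\<close>

definition separation_assm ::
  "real \<Rightarrow> nat \<Rightarrow> nat \<Rightarrow> nat \<Rightarrow> (nat \<Rightarrow> nat \<Rightarrow> real) \<Rightarrow> (nat \<Rightarrow> real) \<Rightarrow> real \<Rightarrow> real \<Rightarrow> bool" where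
  "separation_assm C0 d n m \<mu>s ws lmin Dmax \<longleftrightarrow>
     (let wmin = Min (ws ` {..<m}) in
       \<forall>i<m. \<forall>j<m. i \<noteq> j \<longrightarrow>
         dist_n d (\<mu>s i) (\<mu>s j) \<ge>
           C0 * Max {sqrt Dmax * (real d * real n) powr (1 / 4),
                     sqrt (real d / wmin),
                     sqrt (ln (Dmax * real d * real n * real m / (lmin * wmin)))})"

end

theory Submission
  imports Defs "HOL-Real_Asymp.Real_Asymp"
begin

text \<open>
  With the responsibilities \<open>r\<^sub>i = \<pi>\<^sub>i \<phi>(\<cdot> | \<mu>\<^sub>i) / p\<close>, which lie in \<open>[0, 1]\<close>, differentiating twice
  under the integral is justified by second moments of the teacher.  At an exact clustering
  \<open>p = p\<^sup>\<star>\<close>, so the Hessian is the Fisher information, the Gram matrix of the scores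
  \<open>r\<^sub>i (x\<^sub>a - \<mu>\<^sub>i\<^sub>a)\<close> in \<open>L\<^sup>2(p\<^sup>\<star>)\<close>.  Hence \<open>u\<close> is in its kernel iff
  \<open>\<Sum>\<^sub>i \<pi>\<^sub>i (u\<^sub>i \<bullet> (x - \<mu>\<^sub>i)) \<phi>(x | \<mu>\<^sub>i) = \<Sum>\<^sub>l (Avg\<^sub>l(u) \<bullet> (x - \<mu>\<^sup>\<star>\<^sub>l)) \<phi>(x | \<mu>\<^sup>\<star>\<^sub>l)\<close> vanishes for
  almost every \<open>x\<close>, hence for every \<open>x\<close>, and the Gaussian scores at distinct centres are linearly
  independent.  The separation assumption makes the centres distinct, already with \<open>C = 1\<close>.
\<close>

section \<open>Differentiation under the integral sign\<close>

text \<open>The mean value theorem turns the bound on \<open>f'\<close> into a Lipschitz bound with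
  constant \<open>h x\<close>, so \<open>h\<close> dominates the difference quotients and dominated
  convergence applies along every sequence tending to \<open>t0\<close>. The same Lipschitz bound
  carries integrability from \<open>t0\<close> to its neighbours.\<close>

lemma has_real_derivative_integral:
  fixes f f' :: "real \<Rightarrow> 'a \<Rightarrow> real"
  assumes meas: "\<And>t. f t \<in> borel_measurable M"
    and meas': "f' t0 \<in> borel_measurable M"
    and int0: "integrable M (f t0)"
    and deriv: "\<And>t x. x \<in> space M \<Longrightarrow> ((\<lambda>t. f t x) has_real_derivative f' t x) (at t)"
    and bound: "\<And>t x. x \<in> space M \<Longrightarrow> \<bar>t - t0\<bar> < 1 \<Longrightarrow> \<bar>f' t x\<bar> \<le> h x"
    and int_h: "integrable M h"
  shows "((\<lambda>t. \<integral>x. f t x \<partial>M) has_real_derivative (\<integral>x. f' t0 x \<partial>M)) (at t0)"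
proof -
  have lip: "\<bar>f t x - f t0 x\<bar> \<le> h x * \<bar>t - t0\<bar>" if x: "x \<in> space M" and t: "\<bar>t - t0\<bar> < 1" for t x
  proof -
    have "norm (f t x - f t0 x) \<le> h x * norm (t - t0)"
    proof (rule field_differentiable_bound[of "{t. \<bar>t - t0\<bar> < 1}" "\<lambda>t. f t x" "\<lambda>t. f' t x"])
      have "{t. \<bar>t - t0\<bar> < 1} = ball t0 1"
        by (auto simp: dist_real_def)
      then show "convex {t. \<bar>t - t0\<bar> < 1}" by simp
    qed (use t x deriv bound in \<open>auto intro: has_field_derivative_at_within\<close>)
    then show ?thesis by simp
  qed
  have int: "integrable M (f t)" if t: "\<bar>t - t0\<bar> < 1" for t
  proof -
    have "integrable M (\<lambda>x. f t x - f t0 x)"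
      by (rule Bochner_Integration.integrable_bound[of M "\<lambda>x. h x * \<bar>t - t0\<bar>"])
        (use meas int_h lip t in \<open>auto intro!: AE_I2 intro: order_trans[OF _ abs_ge_self]\<close>)
    from Bochner_Integration.integrable_add[OF this int0] show ?thesis by simp
  qed
  show ?thesis
    unfolding has_field_derivative_iff tendsto_at_iff_sequentially
  proof (intro allI impI)
    fix X :: "nat \<Rightarrow> real"
    assume X: "\<forall>i. X i \<in> UNIV - {t0}" "X \<longlonglongrightarrow> t0"
    \<comment> \<open>Domination is available only within distance 1 of \<open>t0\<close>, so the
      first \<open>N\<close> terms of the sequence are dropped and the limit is shifted back at the
      end.\<close>
    then obtain N where N: "\<And>i. i \<ge> N \<Longrightarrow> \<bar>X i - t0\<bar> < 1"
      using LIMSEQ_D[of X t0 1] by auto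
    have lim: "(\<lambda>i. \<integral>x. (f (X (i + N)) x - f t0 x) / (X (i + N) - t0) \<partial>M) \<longlonglongrightarrow> (\<integral>x. f' t0 x \<partial>M)"
    proof (rule integral_dominated_convergence[where w = h])
      show "AE x in M. (\<lambda>i. (f (X (i + N)) x - f t0 x) / (X (i + N) - t0)) \<longlonglongrightarrow> f' t0 x"
      proof (rule AE_I2)
        fix x assume "x \<in> space M"
        from deriv[OF this, of t0] X
        have "((\<lambda>t. (f t x - f t0 x) / (t - t0)) \<circ> X) \<longlonglongrightarrow> f' t0 x"
          unfolding has_field_derivative_iff tendsto_at_iff_sequentially by blast
        then show "(\<lambda>i. (f (X (i + N)) x - f t0 x) / (X (i + N) - t0)) \<longlonglongrightarrow> f' t0 x"
          unfolding o_def by (rule LIMSEQ_ignore_initial_segment)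
      qed
      show "AE x in M. norm ((f (X (i + N)) x - f t0 x) / (X (i + N) - t0)) \<le> h x" for i
        using lip[OF _ N[of "i + N"]] X(1) by (auto intro!: AE_I2 simp: divide_simps)
    qed (use meas meas' int_h in auto)
    have eq: "(\<integral>x. (f (X (i + N)) x - f t0 x) / (X (i + N) - t0) \<partial>M) =
        ((\<integral>x. f (X (i + N)) x \<partial>M) - (\<integral>x. f t0 x \<partial>M)) / (X (i + N) - t0)" for i
      using int[OF N[of "i + N"]] int0 by simp
    show "((\<lambda>t. ((\<integral>x. f t x \<partial>M) - (\<integral>x. f t0 x \<partial>M)) / (t - t0)) \<circ> X) \<longlonglongrightarrow> (\<integral>x. f' t0 x \<partial>M)"
      unfolding o_def by (rule LIMSEQ_offset[where k = N]) (use lim in \<open>simp only: eq\<close>)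
  qed
qed

section \<open>Gaussian densities and mixtures: bounds and moments\<close>

lemma dist_n_power2: "(dist_n d x y)\<^sup>2 = (\<Sum>c<d. (x c - y c)\<^sup>2)"
  unfolding dist_n_def L2_set_def by (simp add: sum_nonneg)

lemma gauss_pos: "gauss d \<mu> x > 0"
  unfolding gauss_def by simp

lemma gauss_le: "gauss d \<mu> x \<le> (2 * pi) powr (- real d / 2)"
  unfolding gauss_def by (rule mult_left_le) auto

lemma gauss_eq_prod: "gauss d \<mu> x = (\<Prod>c<d. normal_density (\<mu> c) 1 (x c))"
proof -
  have "(2 * pi) powr (- real d / 2) = (1 / sqrt (2 * pi)) ^ d"
    by (simp add: powr_minus_divide powr_half_sqrt_powr powr_realpow power_one_over real_sqrt_mult
        real_sqrt_power power_mult_distrib)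
  then show ?thesis
    unfolding gauss_def dist_n_power2 normal_density_def
    by (simp add: prod.distrib prod_dividef power_one_over exp_sum sum_divide_distrib flip: sum_negf)
qed

lemma gauss_measurable [measurable]: "gauss d \<mu> \<in> borel_measurable (lborel_n d)"
  unfolding gauss_def dist_n_power2 by measurable

lemma mixture_measurable [measurable]: "mixture d k \<mu> w \<in> borel_measurable (lborel_n d)"
  unfolding mixture_def by measurable

lemma mixture_pos:
  assumes "k > 0" "\<forall>i<k. w i > 0"
  shows "mixture d k \<mu> w x > 0"
  unfolding mixture_def using assms by (intro sum_pos) (auto simp: gauss_pos)

lemma component_le_mixture:
  assumes "\<forall>i<k. w i > 0" "j < k"
  shows "w j * gauss d (\<mu> j) x \<le> mixture d k \<mu> w x"
  unfolding mixture_def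
  using assms by (intro member_le_sum) (auto intro!: mult_nonneg_nonneg less_imp_le simp: gauss_pos)

text \<open>Density and monomial both factor over the coordinates, so Fubini reduces the integral to
  one-dimensional normal moments. The free exponents \<open>e\<close> cover total mass and
  covariance at once.\<close>

lemma has_bochner_integral_gauss_moment:
  fixes e :: "nat \<Rightarrow> nat"
  shows "has_bochner_integral (lborel_n d) (\<lambda>x. gauss d \<mu> x * (\<Prod>c<d. (x c - \<mu> c) ^ e c))
           (\<Prod>c<d. \<integral>y. normal_density (\<mu> c) 1 y * (y - \<mu> c) ^ e c \<partial>lborel)"
proof -
  interpret product_sigma_finite "\<lambda>_::nat. lborel :: real measure"
    by standard
  have "integrable lborel (\<lambda>y. normal_density (\<mu> c) 1 y * (y - \<mu> c) ^ e c)" for c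
    by (rule integrable_normal_moment) simp
  then show ?thesis
    by (simp add: has_bochner_integral_iff gauss_eq_prod flip: prod.distrib)
      (intro conjI product_integrable_prod[where f = "\<lambda>c y. normal_density (\<mu> c) 1 y * (y - \<mu> c) ^ e c"]
        product_integral_prod[where f = "\<lambda>c y. normal_density (\<mu> c) 1 y * (y - \<mu> c) ^ e c"]; simp)
qed

lemma gauss_covariance:
  assumes "a < d" "b < d"
  shows "has_bochner_integral (lborel_n d) (\<lambda>x. gauss d \<mu> x * ((x a - \<mu> a) * (x b - \<mu> b))) (of_bool (a = b))"
proof -
  \<comment> \<open>Adding the two indicators treats both cases together: exponent 2 at
    \<open>a\<close> if \<open>a = b\<close>, otherwise exponent 1 at each of \<open>a\<close> and
    \<open>b\<close>.\<close>
  define e :: "nat \<Rightarrow> nat" where "e c = of_bool (c = a) + of_bool (c = b)" for c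
  have 1: "(\<Prod>c<d. (x c - \<mu> c) ^ e c) = (x a - \<mu> a) * (x b - \<mu> b)" for x
  proof -
    have "(\<Prod>c<d. (x c - \<mu> c) ^ e c) =
        (\<Prod>c<d. if c = a then x c - \<mu> c else 1) * (\<Prod>c<d. if c = b then x c - \<mu> c else 1)"
      unfolding prod.distrib[symmetric] e_def by (intro prod.cong) auto
    then show ?thesis using assms by (simp add: prod.delta)
  qed
  \<comment> \<open>Exponents are 0, 1 or 2, and the corresponding central moments of a
    standard-variance normal are 1, 0 and 1.\<close>
  have m: "(\<integral>y. normal_density (\<mu> c) 1 y * (y - \<mu> c) ^ e c \<partial>lborel) = of_bool (e c \<noteq> 1)" for c
    using integral_normal_moment_even[of 1 "\<mu> c" 0] integral_normal_moment_even[of 1 "\<mu> c" 1]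
      integral_normal_moment_odd[of 1 "\<mu> c" 0]
    by (auto simp: e_def numeral_2_eq_2)
  have "(\<Prod>c<d. of_bool (e c \<noteq> 1) :: real) = of_bool (a = b)"
  proof (cases "a = b")
    case True
    then show ?thesis by (auto simp: e_def intro!: prod.neutral)
  next
    case False
    then show ?thesis using assms by (auto simp: e_def intro!: bexI[of _ a])
  qed
  with has_bochner_integral_gauss_moment[of d \<mu> e] show ?thesis
    by (simp add: 1 m)
qed

lemma gauss_total: "has_bochner_integral (lborel_n d) (gauss d \<mu>) 1"
  using has_bochner_integral_gauss_moment[of d \<mu> "\<lambda>_. 0"] integral_normal_moment_even[of 1 _ 0] by simp

lemma integrable_gauss_square:
  assumes "c < d"
  shows "integrable (lborel_n d) (\<lambda>x. gauss d \<mu> x * (x c)\<^sup>2)"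
proof (rule Bochner_Integration.integrable_bound)
  show "integrable (lborel_n d)
      (\<lambda>x. 2 * (gauss d \<mu> x * ((x c - \<mu> c) * (x c - \<mu> c))) + 2 * (\<mu> c)\<^sup>2 * gauss d \<mu> x)"
    using gauss_covariance[OF assms assms, of \<mu>] gauss_total[of d \<mu>]
    by (auto simp: has_bochner_integral_iff)
  show "(\<lambda>x. gauss d \<mu> x * (x c)\<^sup>2) \<in> borel_measurable (lborel_n d)"
    by measurable (use assms in simp)
  \<comment> \<open>The two sides differ by the square of \<open>x c - 2 * \<mu> c\<close>.\<close>
  have "(x c)\<^sup>2 \<le> 2 * ((x c - \<mu> c) * (x c - \<mu> c)) + 2 * (\<mu> c)\<^sup>2" for x
    using zero_le_power2[of "x c - 2 * \<mu> c"] by (simp add: power2_eq_square algebra_simps)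
  from mult_left_mono[OF this, of "gauss d \<mu> _"]
  show "AE x in lborel_n d. norm (gauss d \<mu> x * (x c)\<^sup>2) \<le>
      norm (2 * (gauss d \<mu> x * ((x c - \<mu> c) * (x c - \<mu> c))) + 2 * (\<mu> c)\<^sup>2 * gauss d \<mu> x)"
    using gauss_pos[of d \<mu>]
    by (intro AE_I2) (auto simp: algebra_simps less_imp_le intro!: order_trans[OF _ abs_ge_self])
qed

section \<open>Derivatives in a single coordinate of a single centre\<close>

lemma DERIV_gauss:
  assumes "b < d"
  shows "((\<lambda>t. gauss d (\<mu>(b := t)) x) has_real_derivative (x b - t) * gauss d (\<mu>(b := t)) x) (at t)"
proof -
  have eq: "gauss d (\<mu>(b := t)) x =
     (2 * pi) powr (- real d / 2) * exp (- ((x b - t)\<^sup>2 + (\<Sum>c\<in>{..<d} - {b}. (x c - \<mu> c)\<^sup>2)) / 2)" for t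
  proof -
    have "(\<Sum>c<d. (x c - (\<mu>(b := t)) c)\<^sup>2) = (x b - t)\<^sup>2 + (\<Sum>c\<in>{..<d} - {b}. (x c - \<mu> c)\<^sup>2)"
      using assms by (subst sum.remove[of _ b]) auto
    then show ?thesis by (simp add: gauss_def dist_n_power2)
  qed
  show ?thesis
    unfolding eq by (auto intro!: derivative_eq_intros)
qed

text \<open>The line along which \<open>partial\<close> differentiates. Naming it allows derivatives
  to be stated at every \<open>t\<close>, as the mean value argument requires.\<close>

definition update :: "(nat \<Rightarrow> nat \<Rightarrow> real) \<Rightarrow> nat \<Rightarrow> nat \<Rightarrow> real \<Rightarrow> nat \<Rightarrow> nat \<Rightarrow> real" where
  "update \<nu> i a t = \<nu>(i := (\<nu> i)(a := t))"

lemma update_self [simp]: "update \<nu> i a (\<nu> i a) = \<nu>"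
  by (simp add: update_def)

lemma partial_eqI:
  assumes "((\<lambda>t. f (update \<nu> i a t)) has_real_derivative D) (at (\<nu> i a))"
  shows "partial (i, a) f \<nu> = D"
  using DERIV_imp_deriv[OF assms] by (simp add: partial_def update_def)

lemma DERIV_component:
  assumes "a < d"
  shows "((\<lambda>t. gauss d (update \<nu> i a t k) x) has_real_derivative
     of_bool (k = i) * (x a - t) * gauss d (update \<nu> i a t k) x) (at t)"
  using DERIV_gauss[OF assms, of "\<nu> i" x t] by (auto simp: update_def)

lemma DERIV_mixture:
  assumes "i < n" "a < d"
  shows "((\<lambda>t. mixture d n (update \<nu> i a t) w x) has_real_derivative
     w i * gauss d (update \<nu> i a t i) x * (x a - t)) (at t)"
proof -
  have "((\<lambda>t. mixture d n (update \<nu> i a t) w x) has_real_derivative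
     (\<Sum>k<n. w k * (of_bool (k = i) * (x a - t) * gauss d (update \<nu> i a t k) x))) (at t)"
    unfolding mixture_def
    by (intro DERIV_sum DERIV_cmult DERIV_component assms)
  also have "(\<Sum>k<n. w k * (of_bool (k = i) * (x a - t) * gauss d (update \<nu> i a t k) x)) =
     w i * gauss d (update \<nu> i a t i) x * (x a - t)"
    using assms by (subst sum.remove[of _ i]) (auto intro!: sum.neutral)
  finally show ?thesis .
qed

definition resp :: "nat \<Rightarrow> nat \<Rightarrow> (nat \<Rightarrow> real) \<Rightarrow> (nat \<Rightarrow> nat \<Rightarrow> real) \<Rightarrow> nat \<Rightarrow> (nat \<Rightarrow> real) \<Rightarrow> real" where
  "resp d n w \<nu> i x = w i * gauss d (\<nu> i) x / mixture d n \<nu> w x"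

lemma resp_measurable [measurable]: "resp d n w \<nu> i \<in> borel_measurable (lborel_n d)"
  unfolding resp_def by measurable

lemma resp_bounds:
  assumes "\<forall>i<n. w i > 0" "i < n"
  shows "0 \<le> resp d n w \<nu> i x" "resp d n w \<nu> i x \<le> 1"
proof -
  have "mixture d n \<nu> w x > 0"
    using assms by (intro mixture_pos) auto
  then show "0 \<le> resp d n w \<nu> i x" "resp d n w \<nu> i x \<le> 1"
    using component_le_mixture[of n w i d \<nu> x] assms gauss_pos[of d "\<nu> i" x]
    by (auto simp: resp_def divide_simps intro!: mult_nonneg_nonneg less_imp_le)
qed

text \<open>Responsibilities are the softmax of the logarithms of the weighted component densities.
  Only the \<open>i\<close>-th logarithm moves, at rate \<open>x a - t\<close>, so this is the
  softmax derivative.\<close>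

lemma DERIV_resp:
  assumes w: "\<forall>i<n. w i > 0" and "i < n" "a < d"
  shows "((\<lambda>t. resp d n w (update \<nu> i a t) j x) has_real_derivative
     resp d n w (update \<nu> i a t) j x * (of_bool (i = j) - resp d n w (update \<nu> i a t) i x) * (x a - t)) (at t)"
proof -
  have pos: "mixture d n (update \<nu> i a t) w x > 0"
    using assms by (intro mixture_pos) auto
  have "((\<lambda>t. w j * gauss d (update \<nu> i a t j) x / mixture d n (update \<nu> i a t) w x) has_real_derivative
     ((w j * (of_bool (j = i) * (x a - t) * gauss d (update \<nu> i a t j) x)) * mixture d n (update \<nu> i a t) w x
      - w j * gauss d (update \<nu> i a t j) x * (w i * gauss d (update \<nu> i a t i) x * (x a - t)))
      / (mixture d n (update \<nu> i a t) w x * mixture d n (update \<nu> i a t) w x)) (at t)"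
    using pos assms by (intro DERIV_divide DERIV_cmult DERIV_component DERIV_mixture) auto
  then show ?thesis
    unfolding resp_def by (rule DERIV_cong) (use pos in \<open>auto simp: field_simps\<close>)
qed

section \<open>Differentiating the loss twice under a measure with second moments\<close>

locale second_moment_measure = finite_measure P for P :: "(nat \<Rightarrow> real) measure" +
  fixes d :: nat
  assumes sets_P [measurable_cong]: "sets P = sets (lborel_n d)"
    and integrable_square: "\<And>c. c < d \<Longrightarrow> integrable P (\<lambda>x. (x c)\<^sup>2)"
begin

lemma coordinate_measurable: "c < d \<Longrightarrow> (\<lambda>x. x c) \<in> borel_measurable P"
  unfolding measurable_cong_sets[OF sets_P refl] by measurable

lemma integrable_coordinate:
  assumes "c < d"
  shows "integrable P (\<lambda>x. x c)"
proof (rule Bochner_Integration.integrable_bound)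
  show "integrable P (\<lambda>x. 1 + (x c)\<^sup>2)"
    using assms by (simp add: integrable_square)
  have "\<bar>y\<bar> \<le> 1 + y\<^sup>2" for y :: real
    using zero_le_power2[of "\<bar>y\<bar> - 1"] by (simp add: power2_diff)
  then show "AE x in P. norm (x c) \<le> norm (1 + (x c)\<^sup>2)"
    by (auto intro!: AE_I2 intro: order_trans[OF _ abs_ge_self])
qed (use assms coordinate_measurable in auto)

text \<open>Gaussians are bounded, so the logarithm is bounded above by a constant. Keeping only
  component 0 bounds it below by a constant minus half a squared distance, which is
  integrable.\<close>

lemma integrable_ln_mixture:
  assumes "k > 0" "\<forall>i<k. w i > 0"
  shows "integrable P (\<lambda>x. ln (mixture d k \<nu> w x))"
proof (rule Bochner_Integration.integrable_bound)
  define c where "c = (2 * pi) powr (- real d / 2)"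
  have c: "c > 0" by (simp add: c_def)
  define W where "W = (\<Sum>i<k. w i)"
  have "(dist_n d x (\<nu> 0))\<^sup>2 = (\<Sum>a<d. (x a)\<^sup>2 + (\<nu> 0 a)\<^sup>2 - 2 * x a * \<nu> 0 a)" for x
    by (simp add: dist_n_power2 power2_diff)
  then have "integrable P (\<lambda>x. (dist_n d x (\<nu> 0))\<^sup>2)"
    by (auto simp: integrable_square intro!: Bochner_Integration.integrable_sum
        Bochner_Integration.integrable_diff Bochner_Integration.integrable_add
        Bochner_Integration.integrable_mult_left Bochner_Integration.integrable_mult_right integrable_coordinate)
  then show "integrable P (\<lambda>x. \<bar>ln (W * c)\<bar> + \<bar>ln (w 0 * c)\<bar> + (dist_n d x (\<nu> 0))\<^sup>2 / 2)"
    by simp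
  have "\<bar>ln (mixture d k \<nu> w x)\<bar> \<le> \<bar>ln (W * c)\<bar> + \<bar>ln (w 0 * c)\<bar> + (dist_n d x (\<nu> 0))\<^sup>2 / 2" for x
  proof -
    have pos: "mixture d k \<nu> w x > 0" by (rule mixture_pos) (use assms in auto)
    have "mixture d k \<nu> w x \<le> W * c"
      unfolding mixture_def W_def c_def sum_distrib_right
      using assms by (intro sum_mono mult_left_mono gauss_le) (auto simp: less_imp_le)
    with pos have up: "ln (mixture d k \<nu> w x) \<le> ln (W * c)" by simp
    have "w 0 * c * exp (- (dist_n d x (\<nu> 0))\<^sup>2 / 2) \<le> mixture d k \<nu> w x"
      using component_le_mixture[of k w 0 d \<nu> x] assms by (simp add: gauss_def c_def mult.assoc)
    moreover have "w 0 * c > 0" using assms c by simp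
    ultimately have "ln (w 0 * c * exp (- (dist_n d x (\<nu> 0))\<^sup>2 / 2)) \<le> ln (mixture d k \<nu> w x)"
      using pos by (subst ln_le_cancel_iff) auto
    also have "ln (w 0 * c * exp (- (dist_n d x (\<nu> 0))\<^sup>2 / 2)) = ln (w 0 * c) - (dist_n d x (\<nu> 0))\<^sup>2 / 2"
      using \<open>w 0 * c > 0\<close> by (subst ln_mult_pos) auto
    finally show ?thesis using up zero_le_power2[of "dist_n d x (\<nu> 0)"] by linarith
  qed
  then show "AE x in P. norm (ln (mixture d k \<nu> w x)) \<le>
      norm (\<bar>ln (W * c)\<bar> + \<bar>ln (w 0 * c)\<bar> + (dist_n d x (\<nu> 0))\<^sup>2 / 2)"
    by (auto intro!: AE_I2 intro: order_trans[OF _ abs_ge_self])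
qed simp_all

text \<open>The base point \<nu> is arbitrary, so this gives the first partial derivative as a
  function of the centres, ready to be differentiated again.\<close>

lemma DERIV_integral_ln:
  assumes w: "\<forall>i<n. w i > 0" and "j < n" "b < d"
    and q: "\<And>x. q x > 0" "q \<in> borel_measurable (lborel_n d)" "integrable P (\<lambda>x. ln (q x))"
  shows "((\<lambda>t. \<integral>x. ln (q x / mixture d n (update \<nu> j b t) w x) \<partial>P) has_real_derivative
     (\<integral>x. - (resp d n w \<nu> j x * (x b - \<nu> j b)) \<partial>P)) (at (\<nu> j b))"
proof -
  note [measurable] = q(2) coordinate_measurable[OF \<open>b < d\<close>]
  have pos: "mixture d n \<nu> w x > 0" for \<nu> x
    using assms by (intro mixture_pos) auto
  define f' where "f' t x = - (resp d n w (update \<nu> j b t) j x * (x b - t))" for t x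
  have "((\<lambda>t. \<integral>x. ln (q x / mixture d n (update \<nu> j b t) w x) \<partial>P) has_real_derivative
     (\<integral>x. f' (\<nu> j b) x \<partial>P)) (at (\<nu> j b))"
  proof (rule has_real_derivative_integral)
    show "integrable P (\<lambda>x. ln (q x / mixture d n (update \<nu> j b (\<nu> j b)) w x))"
      using q pos \<open>j < n\<close> w
      by (auto simp: ln_div less_imp_neq[symmetric] intro!: Bochner_Integration.integrable_diff integrable_ln_mixture)
    \<comment> \<open>The majorant combines three bounds: the responsibility is at most 1,
      \<open>t\<close> stays within 1 of \<open>\<nu> j b\<close>, and
      \<open>\<bar>y\<bar> \<le> 1 + y\<^sup>2\<close>.\<close>
    show "integrable P (\<lambda>x. (x b)\<^sup>2 + 2 + \<bar>\<nu> j b\<bar>)"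
      using assms by (simp add: integrable_square)
    show "\<bar>f' t x\<bar> \<le> (x b)\<^sup>2 + 2 + \<bar>\<nu> j b\<bar>" if "\<bar>t - \<nu> j b\<bar> < 1" for t x
    proof -
      have f': "\<bar>f' t x\<bar> \<le> 1 * \<bar>x b - t\<bar>"
        unfolding f'_def abs_minus_cancel abs_mult
        using resp_bounds[OF w \<open>j < n\<close>, of d "update \<nu> j b t" x] by (intro mult_right_mono) auto
      have "\<bar>x b\<bar> \<le> 1 + (x b)\<^sup>2"
        using zero_le_power2[of "\<bar>x b\<bar> - 1"] by (simp add: power2_diff)
      moreover have "\<bar>x b - t\<bar> \<le> \<bar>x b\<bar> + \<bar>\<nu> j b\<bar> + 1"
        using that by linarith
      ultimately have "\<bar>x b - t\<bar> \<le> (x b)\<^sup>2 + 2 + \<bar>\<nu> j b\<bar>" by linarith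
      with f' show ?thesis unfolding mult_1 by (rule order_trans)
    qed
    show "((\<lambda>t. ln (q x / mixture d n (update \<nu> j b t) w x)) has_real_derivative f' t x) (at t)" for t x
    proof -
      have "((\<lambda>t. ln (q x) - ln (mixture d n (update \<nu> j b t) w x)) has_real_derivative
         0 - inverse (mixture d n (update \<nu> j b t) w x) * (w j * gauss d (update \<nu> j b t j) x * (x b - t))) (at t)"
        by (intro DERIV_diff DERIV_const DERIV_chain2[OF DERIV_ln] pos DERIV_mixture assms)
      moreover have "ln (q x / mixture d n (update \<nu> j b t) w x) = ln (q x) - ln (mixture d n (update \<nu> j b t) w x)" for t
        using q(1)[of x] pos[of "update \<nu> j b t" x] by (simp add: ln_div)
      ultimately show ?thesis
        by (simp add: f'_def resp_def divide_inverse mult_ac)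
    qed
  qed (simp_all add: f'_def, measurable)
  then show ?thesis by (simp add: f'_def)
qed

text \<open>Product rule: the first summand comes from the factor \<open>x b - \<nu> j b\<close>,
  which moves only if the two coordinates coincide, the second from the responsibility.\<close>

lemma DERIV_integral_resp:
  assumes w: "\<forall>i<n. w i > 0" and "i < n" "j < n" "a < d" "b < d"
  shows "((\<lambda>t. \<integral>x. - (resp d n w (update \<nu> i a t) j x * (x b - update \<nu> i a t j b)) \<partial>P) has_real_derivative
     (\<integral>x. of_bool (i = j \<and> a = b) * resp d n w \<nu> j x
        - resp d n w \<nu> j x * (of_bool (i = j) - resp d n w \<nu> i x) * (x a - \<nu> i a) * (x b - \<nu> j b) \<partial>P))
     (at (\<nu> i a))"
proof -
  note [measurable] = coordinate_measurable[OF \<open>a < d\<close>] coordinate_measurable[OF \<open>b < d\<close>]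
  define f' where "f' t x = of_bool (i = j \<and> a = b) * resp d n w (update \<nu> i a t) j x
     - resp d n w (update \<nu> i a t) j x * (of_bool (i = j) - resp d n w (update \<nu> i a t) i x)
       * (x a - t) * (x b - update \<nu> i a t j b)" for t x
  \<comment> \<open>\<open>K\<close> bounds both centre coordinates throughout the unit
    neighbourhood, including the case where \<open>update\<close> moves the coordinate
    \<open>(j, b)\<close> itself.\<close>
  define K where "K = \<bar>\<nu> i a\<bar> + \<bar>\<nu> j b\<bar> + 1"
  have "((\<lambda>t. \<integral>x. - (resp d n w (update \<nu> i a t) j x * (x b - update \<nu> i a t j b)) \<partial>P) has_real_derivative
     (\<integral>x. f' (\<nu> i a) x \<partial>P)) (at (\<nu> i a))"
  proof (rule has_real_derivative_integral)
    show "integrable P (\<lambda>x. (x a)\<^sup>2 + (x b)\<^sup>2 + 2 * K\<^sup>2 + 1)"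
      using assms by (simp add: integrable_square)
    show "\<bar>f' t x\<bar> \<le> (x a)\<^sup>2 + (x b)\<^sup>2 + 2 * K\<^sup>2 + 1" if "\<bar>t - \<nu> i a\<bar> < 1" for t x
    proof -
      let ?r = "\<lambda>j. resp d n w (update \<nu> i a t) j x"
      have r: "0 \<le> ?r i" "?r i \<le> 1" "0 \<le> ?r j" "?r j \<le> 1"
        using resp_bounds[OF w] assms by auto
      have xa: "\<bar>x a - t\<bar> \<le> \<bar>x a\<bar> + K" and xb: "\<bar>x b - update \<nu> i a t j b\<bar> \<le> \<bar>x b\<bar> + K"
        using that by (auto simp: K_def update_def)
      have "\<bar>?r j * (of_bool (i = j) - ?r i)\<bar> \<le> 1"
        unfolding abs_mult using r by (intro mult_le_one) auto
      then have "\<bar>?r j * (of_bool (i = j) - ?r i)\<bar> * (\<bar>x a - t\<bar> * \<bar>x b - update \<nu> i a t j b\<bar>) \<le>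
          1 * ((\<bar>x a\<bar> + K) * (\<bar>x b\<bar> + K))"
        using xa xb by (intro mult_mono) auto
      also have "\<dots> \<le> (x a)\<^sup>2 + (x b)\<^sup>2 + 2 * K\<^sup>2"
      proof -
        have "2 * ((\<bar>x a\<bar> + K) * (\<bar>x b\<bar> + K)) \<le> (\<bar>x a\<bar> + K)\<^sup>2 + (\<bar>x b\<bar> + K)\<^sup>2"
          using zero_le_power2[of "(\<bar>x a\<bar> + K) - (\<bar>x b\<bar> + K)"] by (simp only: power2_diff mult.assoc)
        moreover have "(\<bar>y\<bar> + K)\<^sup>2 \<le> 2 * (y\<^sup>2 + K\<^sup>2)" for y
          using zero_le_power2[of "\<bar>y\<bar> - K"] by (simp add: power2_diff power2_sum)
        from this[of "x a"] this[of "x b"] have "(\<bar>x a\<bar> + K)\<^sup>2 + (\<bar>x b\<bar> + K)\<^sup>2 \<le> 2 * ((x a)\<^sup>2 + (x b)\<^sup>2 + 2 * K\<^sup>2)"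
          by simp
        ultimately show ?thesis
          unfolding mult_1 by (smt (verit) zero_le_power2)
      qed
      finally have "\<bar>?r j * (of_bool (i = j) - ?r i) * (x a - t) * (x b - update \<nu> i a t j b)\<bar> \<le>
          (x a)\<^sup>2 + (x b)\<^sup>2 + 2 * K\<^sup>2"
        by (simp only: abs_mult mult.assoc)
      moreover have "\<bar>of_bool (i = j \<and> a = b) * ?r j\<bar> \<le> 1"
        using r by auto
      ultimately show ?thesis
        unfolding f'_def by linarith
    qed
    show "((\<lambda>t. - (resp d n w (update \<nu> i a t) j x * (x b - update \<nu> i a t j b)))
        has_real_derivative f' t x) (at t)" for t x
    proof -
      have "((\<lambda>t. update \<nu> i a t j b) has_real_derivative of_bool (i = j \<and> a = b)) (at t)"
        by (cases "i = j"; cases "a = b") (auto simp: update_def)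
      then show ?thesis
        by (auto intro!: derivative_eq_intros DERIV_resp[OF w] assms simp: f'_def)
    qed
    show "integrable P (\<lambda>x. - (resp d n w (update \<nu> i a (\<nu> i a)) j x * (x b - update \<nu> i a (\<nu> i a) j b)))"
    proof (rule Bochner_Integration.integrable_bound)
      show "integrable P (\<lambda>x. x b - \<nu> j b)"
        using assms by (simp add: integrable_coordinate)
      show "AE x in P. norm (- (resp d n w (update \<nu> i a (\<nu> i a)) j x * (x b - update \<nu> i a (\<nu> i a) j b)))
          \<le> norm (x b - \<nu> j b)"
        using resp_bounds[OF w \<open>j < n\<close>, of d \<nu>]
        by (auto intro!: AE_I2 mult_left_le_one_le simp: abs_mult)
    qed measurable
  qed (simp_all add: f'_def, measurable)
  then show ?thesis by (simp add: f'_def)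
qed

text \<open>Responsibilities are at most 1, so the product is at most
  \<open>\<bar>x a - s\<bar> * \<bar>x b - t\<bar>\<close>, which second moments control. This later
  justifies exchanging integrals and finite sums.\<close>

lemma integrable_score_product:
  assumes w: "\<forall>i<n. w i > 0" and "i < n" "j < n" "a < d" "b < d"
  shows "integrable P (\<lambda>x. resp d n w \<nu> i x * (x a - s) * (resp d n w \<nu> j x * (x b - t)))"
proof (rule Bochner_Integration.integrable_bound)
  note [measurable] = coordinate_measurable[OF \<open>a < d\<close>] coordinate_measurable[OF \<open>b < d\<close>]
  show "(\<lambda>x. resp d n w \<nu> i x * (x a - s) * (resp d n w \<nu> j x * (x b - t))) \<in> borel_measurable P"
    by measurable
  show "integrable P (\<lambda>x. (x a - s)\<^sup>2 + (x b - t)\<^sup>2)"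
    using assms by (simp add: power2_diff integrable_square integrable_coordinate)
  have "\<bar>resp d n w \<nu> i x * (x a - s) * (resp d n w \<nu> j x * (x b - t))\<bar> \<le> (x a - s)\<^sup>2 + (x b - t)\<^sup>2" for x
  proof -
    have "\<bar>resp d n w \<nu> i x * (x a - s)\<bar> \<le> \<bar>x a - s\<bar>" "\<bar>resp d n w \<nu> j x * (x b - t)\<bar> \<le> \<bar>x b - t\<bar>"
      using resp_bounds[OF w] assms by (auto simp: abs_mult intro!: mult_left_le_one_le)
    then have "\<bar>resp d n w \<nu> i x * (x a - s)\<bar> * \<bar>resp d n w \<nu> j x * (x b - t)\<bar> \<le> \<bar>x a - s\<bar> * \<bar>x b - t\<bar>"
      by (intro mult_mono) auto
    also have "\<dots> \<le> (x a - s)\<^sup>2 + (x b - t)\<^sup>2"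
    proof -
      have "2 * \<bar>x a - s\<bar> * \<bar>x b - t\<bar> \<le> (x a - s)\<^sup>2 + (x b - t)\<^sup>2"
        using zero_le_power2[of "\<bar>x a - s\<bar> - \<bar>x b - t\<bar>"] by (simp add: power2_diff[of "\<bar>_\<bar>"])
      moreover have "0 \<le> \<bar>x a - s\<bar> * \<bar>x b - t\<bar>" by simp
      ultimately show ?thesis by linarith
    qed
    finally show ?thesis by (simp only: abs_mult)
  qed
  then show "AE x in P. norm (resp d n w \<nu> i x * (x a - s) * (resp d n w \<nu> j x * (x b - t))) \<le>
      norm ((x a - s)\<^sup>2 + (x b - t)\<^sup>2)"
    by (auto intro!: AE_I2 intro: order_trans[OF _ abs_ge_self])
qed

end

section \<open>From almost every point to every point, and independence of Gaussian scores\<close>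

text \<open>If \<open>g x\<close> were nonzero, continuity in the product topology would make
  \<open>g\<close> nonzero on an open box around \<open>x\<close>, and the first \<open>d\<close>
  sides of that box span a set of positive measure.\<close>

lemma AE_lborel_n_eq_0_imp:
  fixes g :: "(nat \<Rightarrow> real) \<Rightarrow> real"
  assumes cont: "continuous_on UNIV g" and ae: "AE x in lborel_n d. g x = 0"
    and x: "x \<in> {..<d} \<rightarrow>\<^sub>E UNIV"
  shows "g x = 0"
proof (rule ccontr)
  interpret product_sigma_finite "\<lambda>_::nat. lborel :: real measure"
    by standard
  assume "g x \<noteq> 0"
  define U where "U = {y. g y \<noteq> 0}"
  have "U = g -` (- {0})" by (auto simp: U_def)
  then have "open U"
    using cont by (simp add: open_vimage open_Compl)
  then have "openin (product_topology (\<lambda>_. euclidean) UNIV) U"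
    by (simp add: euclidean_product_topology)
  from product_topology_open_contains_basis[OF this, of x] \<open>g x \<noteq> 0\<close>
  obtain X where X: "\<And>i. x i \<in> X i" "\<And>i. open (X i)" "(\<Pi>\<^sub>E i\<in>UNIV. X i) \<subseteq> U"
    by (auto simp: U_def PiE_iff)
  have pos: "emeasure lborel (X i) > 0" for i
  proof -
    from X(1,2)[of i] obtain e where e: "e > 0" "ball (x i) e \<subseteq> X i"
      by (meson openE)
    have "0 < emeasure lborel {x i - e<..<x i + e}"
      using e by (simp add: emeasure_lborel_Ioo)
    also have "\<dots> \<le> emeasure lborel (X i)"
      using X(2)[of i] e by (intro emeasure_mono) (auto simp: ball_eq_greaterThanLessThan)
    finally show ?thesis .
  qed
  have "emeasure (lborel_n d) (Pi\<^sub>E {..<d} X) = (\<Prod>i<d. emeasure lborel (X i))"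
    using X(2) by (intro emeasure_PiM) auto
  with pos have nz: "emeasure (lborel_n d) (Pi\<^sub>E {..<d} X) \<noteq> 0"
    by (simp add: less_imp_neq[symmetric])
  have sub: "Pi\<^sub>E {..<d} X \<subseteq> U"
  proof
    fix y assume y: "y \<in> Pi\<^sub>E {..<d} X"
    \<comment> \<open>The box constrains all indices. For \<open>i \<ge> d\<close> both extensional
      points take the value \<open>undefined\<close>, so \<open>y\<close> agrees with
      \<open>x\<close> there.\<close>
    have "y i \<in> X i" for i
      using y x X(1)[of i] by (cases "i < d") (auto simp: PiE_iff extensional_def)
    then show "y \<in> U" using X(3) by auto
  qed
  from ae obtain N where N: "{x \<in> space (lborel_n d). g x \<noteq> 0} \<subseteq> N" "emeasure (lborel_n d) N = 0" "N \<in> sets (lborel_n d)"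
    by (auto elim!: AE_E)
  have "Pi\<^sub>E {..<d} X \<subseteq> N"
  proof
    fix y assume y: "y \<in> Pi\<^sub>E {..<d} X"
    then have "y \<in> space (lborel_n d)" by (auto simp: space_PiM PiE_iff)
    moreover have "g y \<noteq> 0" using sub y by (auto simp: U_def)
    ultimately show "y \<in> N" using N(1) by auto
  qed
  from emeasure_mono[OF this N(3)] N(2) nz show False by simp
qed

text \<open>
  Let \<open>\<mu>\<^sub>l\<close> be longest among the centres with \<open>v\<^sub>l \<noteq> 0\<close>.  Along the line \<open>\<mu>\<^sub>l + v\<^sub>l + t \<mu>\<^sub>l\<close> all other
  components decay exponentially relative to the \<open>l\<close>-th, because \<open>\<mu>\<^sub>l \<bullet> (\<mu>\<^sub>l - \<mu>\<^sub>k) > 0\<close>; hence the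
  affine function \<open>\<bar>v\<^sub>l\<bar>\<^sup>2 + t (v\<^sub>l \<bullet> \<mu>\<^sub>l)\<close> tends to \<open>0\<close>.
\<close>

lemma gauss_scores_independent:
  fixes v \<mu> :: "nat \<Rightarrow> nat \<Rightarrow> real"
  assumes dist: "\<forall>k<m. \<forall>l<m. k \<noteq> l \<longrightarrow> (\<exists>c<d. \<mu> k c \<noteq> \<mu> l c)"
    and zero: "\<And>x. (\<Sum>l<m. (\<Sum>a<d. v l a * (x a - \<mu> l a)) * gauss d (\<mu> l) x) = 0"
    and "l < m" "a < d"
  shows "v l a = 0"
proof (rule ccontr)
  assume "v l a \<noteq> 0"
  define N where "N k = (\<Sum>c<d. (\<mu> k c)\<^sup>2)" for k
  define B where "B = {k. k < m \<and> (\<exists>c<d. v k c \<noteq> 0)}"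
  have B: "finite B" "B \<noteq> {}"
    using \<open>v l a \<noteq> 0\<close> assms by (auto simp: B_def)
  have "Max (N ` B) \<in> N ` B"
    using B by (intro Max_in) auto
  then obtain l where l: "l \<in> B" "N l = Max (N ` B)"
    by auto
  have N_le: "N k \<le> N l" if "k \<in> B" for k
    using that B l(2) by simp
  have "l < m" using l by (simp add: B_def)
  define x where "x t c = \<mu> l c + v l c + t * \<mu> l c" for t c
  define e where "e k = (\<Sum>c<d. \<mu> l c * (\<mu> l c - \<mu> k c))" for k
  define r where "r k = (\<Sum>c<d. v l c * (\<mu> l c - \<mu> k c)) + (\<Sum>c<d. (\<mu> l c - \<mu> k c)\<^sup>2) / 2" for k
  define \<alpha> where "\<alpha> k = (\<Sum>c<d. v k c * (\<mu> l c + v l c - \<mu> k c))" for k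
  define \<beta> where "\<beta> k = (\<Sum>c<d. v k c * \<mu> l c)" for k
  have lin: "(\<Sum>a<d. v k a * (x t a - \<mu> k a)) = \<alpha> k + t * \<beta> k" for k t
    by (simp add: x_def \<alpha>_def \<beta>_def sum_distrib_left algebra_simps flip: sum.distrib)
  have gk: "gauss d (\<mu> k) (x t) = gauss d (\<mu> l) (x t) * exp (- r k - t * e k)" for k t
  proof -
    have "(\<Sum>c<d. (x t c - \<mu> k c)\<^sup>2) = (\<Sum>c<d. (x t c - \<mu> l c)\<^sup>2 +
        2 * (v l c * (\<mu> l c - \<mu> k c)) + (\<mu> l c - \<mu> k c)\<^sup>2 + 2 * (t * (\<mu> l c * (\<mu> l c - \<mu> k c))))"
      by (intro sum.cong) (auto simp: x_def power2_eq_square algebra_simps)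
    also have "\<dots> = (\<Sum>c<d. (x t c - \<mu> l c)\<^sup>2) + 2 * r k + 2 * (t * e k)"
      by (simp add: sum.distrib r_def e_def flip: sum_distrib_left)
    finally show ?thesis
      by (simp add: gauss_def dist_n_power2 field_simps flip: exp_add)
  qed
  have e_pos: "e k > 0" if k: "k \<in> B" "k \<noteq> l" for k
  proof -
    \<comment> \<open>Polarisation: the difference of squared lengths is nonnegative by maximality
      of \<open>N l\<close>, and the squared distance of distinct centres is positive.\<close>
    have "2 * e k = N l - N k + (\<Sum>c<d. (\<mu> l c - \<mu> k c)\<^sup>2)"
      unfolding e_def N_def sum_distrib_left sum_subtractf[symmetric] sum.distrib[symmetric]
      by (intro sum.cong) (auto simp: power2_eq_square algebra_simps)
    moreover obtain c where "c < d" "\<mu> k c \<noteq> \<mu> l c"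
      using dist k \<open>l < m\<close> unfolding B_def by blast
    then have "(\<Sum>c<d. (\<mu> l c - \<mu> k c)\<^sup>2) > 0"
      by (intro sum_pos2[of _ c]) auto
    ultimately show ?thesis using N_le[OF k(1)] by linarith
  qed
  have sum0: "\<alpha> l + t * \<beta> l = - (\<Sum>k\<in>B - {l}. (\<alpha> k + t * \<beta> k) * exp (- r k - t * e k))" for t
  proof -
    have "0 = (\<Sum>k<m. (\<alpha> k + t * \<beta> k) * (gauss d (\<mu> l) (x t) * exp (- r k - t * e k)))"
      using zero[of "x t"] by (simp add: lin gk[symmetric])
    also have "\<dots> = gauss d (\<mu> l) (x t) * (\<Sum>k<m. (\<alpha> k + t * \<beta> k) * exp (- r k - t * e k))"
      by (simp add: sum_distrib_left mult_ac)
    finally have "(\<Sum>k<m. (\<alpha> k + t * \<beta> k) * exp (- r k - t * e k)) = 0"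
      using gauss_pos[of d "\<mu> l" "x t"] by simp
    moreover have "(\<Sum>k<m. (\<alpha> k + t * \<beta> k) * exp (- r k - t * e k)) =
        (\<Sum>k\<in>B. (\<alpha> k + t * \<beta> k) * exp (- r k - t * e k))"
      by (intro sum.mono_neutral_right) (auto simp: B_def \<alpha>_def \<beta>_def)
    moreover have "r l = 0" "e l = 0" by (simp_all add: r_def e_def)
    ultimately show ?thesis
      using B l(1) by (simp add: sum.remove[of B l])
  qed
  have "((\<lambda>i. - (\<Sum>k\<in>B - {l}. (\<alpha> k + real i * \<beta> k) * exp (- r k - real i * e k))) \<longlonglongrightarrow> - (\<Sum>k\<in>B - {l}. 0))"
  proof (intro tendsto_minus tendsto_sum)
    fix k assume "k \<in> B - {l}"
    then have "e k > 0" using e_pos by auto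
    then show "(\<lambda>i. (\<alpha> k + real i * \<beta> k) * exp (- r k - real i * e k)) \<longlonglongrightarrow> 0"
      by real_asymp
  qed
  then have lim: "(\<lambda>i. \<alpha> l + real i * \<beta> l) \<longlonglongrightarrow> 0"
    by (simp add: sum0)
  \<comment> \<open>Consecutive terms of the affine sequence differ by \<open>\<beta> l\<close>, so
    the slope is 0; the constant term then vanishes too.\<close>
  from tendsto_diff[OF LIMSEQ_Suc[OF lim] lim] have "\<beta> l = 0"
    by (simp add: algebra_simps LIMSEQ_const_iff)
  with lim have "\<alpha> l = 0"
    by (simp add: LIMSEQ_const_iff)
  then have "(\<Sum>c<d. (v l c)\<^sup>2) = 0"
    by (simp add: \<alpha>_def power2_eq_square)
  with l(1) show False
    by (auto simp: B_def sum_nonneg_eq_0_iff)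
qed

section \<open>The Hessian at an exact clustering and its kernel\<close>

lemma restrict2_eq_0_iff:
  "(\<lambda>i\<in>A. \<lambda>a\<in>B. f i a) = (\<lambda>i\<in>A. \<lambda>a\<in>B. 0 :: real) \<longleftrightarrow> (\<forall>i\<in>A. \<forall>a\<in>B. f i a = 0)"
  (is "?L = ?R \<longleftrightarrow> _")
proof
  assume "?L = ?R"
  then have eq: "?L i a = ?R i a" for i a by simp
  show "\<forall>i\<in>A. \<forall>a\<in>B. f i a = 0"
  proof (intro ballI)
    fix i a assume "i \<in> A" "a \<in> B"
    then show "f i a = 0" using eq[of i a] by simp
  qed
qed (auto simp: restrict_def fun_eq_iff)

locale clustering =
  fixes d n m :: nat and \<mu>s :: "nat \<Rightarrow> nat \<Rightarrow> real" and ws :: "nat \<Rightarrow> real"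
    and \<mu> :: "nat \<Rightarrow> nat \<Rightarrow> real" and w :: "nat \<Rightarrow> real" and S :: "nat \<Rightarrow> nat set"
  assumes m: "m > 0" and ws: "\<forall>l<m. ws l > 0" and n: "n > 0" and w: "\<forall>i<n. w i > 0"
    and clustering: "exact_clustering n m \<mu>s ws S \<mu> w"
begin

definition P :: "(nat \<Rightarrow> real) measure" where
  "P = density (lborel_n d) (\<lambda>x. ennreal (mixture d m \<mu>s ws x))"

lemma p_pos: "mixture d m \<mu>s ws x > 0"
  using m ws by (rule mixture_pos)

lemma integral_P:
  "f \<in> borel_measurable (lborel_n d) \<Longrightarrow>
    (\<integral>x. f x \<partial>P) = (\<integral>x. mixture d m \<mu>s ws x * f x \<partial>lborel_n d)"
  for f :: "(nat \<Rightarrow> real) \<Rightarrow> real"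
  unfolding P_def using p_pos by (subst integral_density) (auto simp: less_imp_le)

lemma integrable_P:
  "f \<in> borel_measurable (lborel_n d) \<Longrightarrow>
    integrable P f \<longleftrightarrow> integrable (lborel_n d) (\<lambda>x. mixture d m \<mu>s ws x * f x)"
  for f :: "(nat \<Rightarrow> real) \<Rightarrow> real"
  unfolding P_def using p_pos by (subst integrable_density) (auto simp: less_imp_le)

text \<open>The teacher law is a finite combination of Gaussians, each with finite mass and second
  moments, so the differentiation results apply to it.\<close>

sublocale second_moment_measure P d
proof (intro second_moment_measure.intro finite_measureI second_moment_measure_axioms.intro)
  have int: "integrable (lborel_n d) (mixture d m \<mu>s ws)"
    unfolding mixture_def using gauss_total by (auto simp: has_bochner_integral_iff)
  show "emeasure P (space P) \<noteq> \<infinity>"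
  proof -
    have "emeasure P (space P) = (\<integral>\<^sup>+x. ennreal (mixture d m \<mu>s ws x) \<partial>lborel_n d)"
      unfolding P_def by (subst emeasure_density) (auto intro!: nn_integral_cong)
    also have "\<dots> < \<infinity>"
      using int p_pos by (subst nn_integral_eq_integral) (auto simp: less_imp_le)
    finally show ?thesis by simp
  qed
  show "sets P = sets (lborel_n d)" by (simp add: P_def)
  show "integrable P (\<lambda>x. (x c)\<^sup>2)" if "c < d" for c
  proof -
    have "(\<lambda>x. (x c)\<^sup>2) \<in> borel_measurable (lborel_n d)"
      by measurable (use that in simp)
    then show ?thesis
      using that by (simp add: integrable_P mixture_def sum_distrib_right mult.assoc integrable_gauss_square)
  qed
qed

lemma sum_clusters: "(\<Sum>i<n. h i) = (\<Sum>l<m. \<Sum>i\<in>S l. h i)" for h :: "nat \<Rightarrow> real"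
proof -
  have un: "{..<n} = (\<Union>l\<in>{..<m}. S l)" and dis: "disjoint_family_on S {..<m}"
    using clustering by (auto simp: exact_clustering_def)
  have "finite (S l)" if "l < m" for l
    using un that by (metis UN_upper finite_lessThan finite_subset lessThan_iff)
  then show ?thesis
    unfolding un using dis by (intro sum.UNION_disjoint) (auto simp: disjoint_family_on_def)
qed

text \<open>Components in a cluster share one centre, and their weights add up to the teacher's.
  Hence the teacher density cancels the denominators of the responsibilities.\<close>

lemma mixture_eq: "mixture d n \<mu> w = mixture d m \<mu>s ws"
proof
  fix x
  have "mixture d n \<mu> w x = (\<Sum>l<m. \<Sum>i\<in>S l. w i * gauss d (\<mu> i) x)"
    unfolding mixture_def by (rule sum_clusters)
  also have "\<dots> = (\<Sum>l<m. (\<Sum>i\<in>S l. w i) * gauss d (\<mu>s l) x)"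
    using clustering unfolding sum_distrib_right
    by (intro sum.cong) (auto simp: exact_clustering_def)
  also have "\<dots> = mixture d m \<mu>s ws x"
    using clustering unfolding mixture_def by (intro sum.cong) (auto simp: exact_clustering_def)
  finally show "mixture d n \<mu> w x = mixture d m \<mu>s ws x" .
qed

abbreviation score :: "nat \<Rightarrow> nat \<Rightarrow> (nat \<Rightarrow> real) \<Rightarrow> real" where
  "score i a x \<equiv> resp d n w \<mu> i x * (x a - \<mu> i a)"

text \<open>Differentiating twice leaves the score product plus a term present only for
  \<open>i = j\<close>. That term has mean zero because each Gaussian has identity
  covariance.\<close>

lemma hessian_loss:
  assumes "i < n" "a < d" "j < n" "b < d"
  shows "hessian (\<lambda>\<nu>. loss d n (mixture d m \<mu>s ws) \<nu> w) \<mu> (i, a) (j, b) = (\<integral>x. score i a x * score j b x \<partial>P)"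
proof -
  note [measurable] = coordinate_measurable[OF \<open>a < d\<close>] coordinate_measurable[OF \<open>b < d\<close>]
  have "partial (j, b) (\<lambda>\<nu>. loss d n (mixture d m \<mu>s ws) \<nu> w) =
      (\<lambda>\<nu>. \<integral>x. - (resp d n w \<nu> j x * (x b - \<nu> j b)) \<partial>P)"
    unfolding loss_def P_def[symmetric]
    by (intro ext partial_eqI DERIV_integral_ln w assms p_pos mixture_measurable integrable_ln_mixture m ws)
  then have "hessian (\<lambda>\<nu>. loss d n (mixture d m \<mu>s ws) \<nu> w) \<mu> (i, a) (j, b) =
      (\<integral>x. of_bool (i = j \<and> a = b) * resp d n w \<mu> j x
        - resp d n w \<mu> j x * (of_bool (i = j) - resp d n w \<mu> i x) * (x a - \<mu> i a) * (x b - \<mu> j b) \<partial>P)"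
    unfolding hessian_def by (simp only:) (intro partial_eqI DERIV_integral_resp w assms)
  also have "\<dots> = (\<integral>x. score i a x * score j b x
      + of_bool (i = j) * (resp d n w \<mu> j x * (of_bool (a = b) - (x a - \<mu> j a) * (x b - \<mu> j b))) \<partial>P)"
    by (intro Bochner_Integration.integral_cong) (auto simp: algebra_simps)
  also have "\<dots> = (\<integral>x. score i a x * score j b x \<partial>P) + of_bool (i = j) * 0"
  proof -
    define f where "f x = resp d n w \<mu> j x * (of_bool (a = b) - (x a - \<mu> j a) * (x b - \<mu> j b))" for x
    have f: "f \<in> borel_measurable P"
      unfolding f_def by measurable
    then have f': "f \<in> borel_measurable (lborel_n d)"
      by (simp add: measurable_cong_sets[OF sets_P refl])
    \<comment> \<open>The density of \<open>P\<close> equals the denominator in \<open>resp\<close>,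
      so only the \<open>j\<close>-th weighted Gaussian survives.\<close>
    have eq: "mixture d m \<mu>s ws x * f x =
        w j * (of_bool (a = b) * gauss d (\<mu> j) x - gauss d (\<mu> j) x * ((x a - \<mu> j a) * (x b - \<mu> j b)))" for x
      using p_pos[of x] by (simp add: f_def resp_def mixture_eq field_simps)
    have "has_bochner_integral (lborel_n d) (\<lambda>x. mixture d m \<mu>s ws x * f x)
        (w j * (of_bool (a = b) * 1 - of_bool (a = b)))"
      unfolding eq
      by (intro has_bochner_integral_mult_right has_bochner_integral_diff gauss_total gauss_covariance assms)
    then have "integrable P f" "(\<integral>x. f x \<partial>P) = 0"
      using f' by (auto simp: integrable_P integral_P has_bochner_integral_iff)
    then show ?thesis
      unfolding f_def[symmetric] using integrable_score_product[OF w, of i j a b] assms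
      by (subst Bochner_Integration.integral_add) auto
  qed
  finally show ?thesis by simp
qed

text \<open>The derivative of the log-density of the mixture at \<mu> in the direction
  \<open>u\<close>.\<close>

definition direction :: "(nat \<Rightarrow> nat \<Rightarrow> real) \<Rightarrow> (nat \<Rightarrow> real) \<Rightarrow> real" where
  "direction u x = (\<Sum>i<n. \<Sum>a<d. score i a x * u i a)"

text \<open>Multiplying by the density clears the denominators. Within a cluster all centres agree,
  so \<open>u\<close> enters only through its cluster averages.\<close>

lemma mixture_direction:
  "mixture d m \<mu>s ws x * direction u x =
     (\<Sum>l<m. (\<Sum>a<d. (\<Sum>i\<in>S l. w i * u i a) * (x a - \<mu>s l a)) * gauss d (\<mu>s l) x)"
proof -
  have "mixture d m \<mu>s ws x * direction u x = (\<Sum>i<n. \<Sum>a<d. w i * gauss d (\<mu> i) x * (x a - \<mu> i a) * u i a)"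
    using p_pos[of x] unfolding direction_def sum_distrib_left
    by (intro sum.cong) (auto simp: resp_def mixture_eq)
  also have "\<dots> = (\<Sum>l<m. \<Sum>i\<in>S l. \<Sum>a<d. w i * gauss d (\<mu> i) x * (x a - \<mu> i a) * u i a)"
    by (rule sum_clusters)
  also have "\<dots> = (\<Sum>l<m. \<Sum>i\<in>S l. \<Sum>a<d. w i * u i a * (x a - \<mu>s l a) * gauss d (\<mu>s l) x)"
    using clustering by (intro sum.cong) (auto simp: exact_clustering_def)
  also have "\<dots> = (\<Sum>l<m. \<Sum>a<d. \<Sum>i\<in>S l. w i * u i a * (x a - \<mu>s l a) * gauss d (\<mu>s l) x)"
    by (intro sum.cong refl sum.swap)
  finally show ?thesis
    by (simp add: sum_distrib_right)
qed

lemma integrable_score_direction: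
  assumes "i < n" "a < d"
  shows "integrable P (\<lambda>x. score i a x * direction u x)"
  unfolding direction_def sum_distrib_left
  using integrable_score_product[OF w] assms
  by (auto intro!: Bochner_Integration.integrable_sum Bochner_Integration.integrable_mult_left
      simp flip: mult.assoc[of _ _ "u _ _"])

lemma hessian_loss_apply:
  assumes "i < n" "a < d"
  shows "(\<Sum>j<n. \<Sum>b<d. hessian (\<lambda>\<nu>. loss d n (mixture d m \<mu>s ws) \<nu> w) \<mu> (i, a) (j, b) * u j b) =
    (\<integral>x. score i a x * direction u x \<partial>P)"
proof -
  have int: "integrable P (\<lambda>x. score i a x * score j b x * u j b)" if "j < n" "b < d" for j b
    using integrable_score_product[OF w] assms that by auto
  have "(\<integral>x. score i a x * direction u x \<partial>P) =
      (\<integral>x. (\<Sum>j<n. \<Sum>b<d. score i a x * score j b x * u j b) \<partial>P)"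
    by (simp add: direction_def sum_distrib_left mult.assoc)
  also have "\<dots> = (\<Sum>j<n. \<Sum>b<d. \<integral>x. score i a x * score j b x * u j b \<partial>P)"
    using int by (subst Bochner_Integration.integral_sum | auto intro!: sum.cong Bochner_Integration.integrable_sum)+
  also have "\<dots> = (\<Sum>j<n. \<Sum>b<d. hessian (\<lambda>\<nu>. loss d n (mixture d m \<mu>s ws) \<nu> w) \<mu> (i, a) (j, b) * u j b)"
    using assms by (intro sum.cong) (auto simp: hessian_loss)
  finally show ?thesis by simp
qed

text \<open>The quadratic form of a Gram matrix is a squared norm, here that of
  \<open>direction u\<close> under the teacher law.\<close>

lemma hessian_loss_quadratic:
  "integrable P (\<lambda>x. (direction u x)\<^sup>2)"
  "(\<integral>x. (direction u x)\<^sup>2 \<partial>P) = (\<Sum>i<n. \<Sum>a<d. u i a *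
     (\<Sum>j<n. \<Sum>b<d. hessian (\<lambda>\<nu>. loss d n (mixture d m \<mu>s ws) \<nu> w) \<mu> (i, a) (j, b) * u j b))"
proof -
  have sq: "(direction u x)\<^sup>2 = (\<Sum>i<n. \<Sum>a<d. u i a * (score i a x * direction u x))" for x
  proof -
    \<comment> \<open>With \<open>D\<close> in place of the second factor, only one factor of the
      square is expanded.\<close>
    have "(\<Sum>i<n. \<Sum>a<d. score i a x * u i a) * D = (\<Sum>i<n. \<Sum>a<d. u i a * (score i a x * D))" for D
      by (simp add: sum_distrib_left sum_distrib_right mult_ac)
    then show ?thesis
      unfolding power2_eq_square direction_def[symmetric] .
  qed
  show "integrable P (\<lambda>x. (direction u x)\<^sup>2)"
    unfolding sq by (auto intro!: Bochner_Integration.integrable_sum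
      Bochner_Integration.integrable_mult_right integrable_score_direction)
  have "(\<integral>x. (direction u x)\<^sup>2 \<partial>P) = (\<Sum>i<n. \<Sum>a<d. \<integral>x. u i a * (score i a x * direction u x) \<partial>P)"
    unfolding sq using integrable_score_direction
    by (subst Bochner_Integration.integral_sum | auto intro!: sum.cong Bochner_Integration.integrable_sum)+
  then show "(\<integral>x. (direction u x)\<^sup>2 \<partial>P) = (\<Sum>i<n. \<Sum>a<d. u i a *
     (\<Sum>j<n. \<Sum>b<d. hessian (\<lambda>\<nu>. loss d n (mixture d m \<mu>s ws) \<nu> w) \<mu> (i, a) (j, b) * u j b))"
    by (simp add: hessian_loss_apply)
qed

text \<open>A vanishing quadratic form makes \<open>direction u\<close> zero almost everywhere. The
  product with the density is a continuous function of \<open>x\<close>, hence zero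
  everywhere.\<close>

lemma direction_eq_0:
  assumes "\<And>i a. i < n \<Longrightarrow> a < d \<Longrightarrow>
    (\<Sum>j<n. \<Sum>b<d. hessian (\<lambda>\<nu>. loss d n (mixture d m \<mu>s ws) \<nu> w) \<mu> (i, a) (j, b) * u j b) = 0"
  shows "mixture d m \<mu>s ws x * direction u x = 0"
proof -
  define g where "g x = mixture d m \<mu>s ws x * direction u x" for x
  have "(\<integral>x. (direction u x)\<^sup>2 \<partial>P) = 0"
    using assms by (simp add: hessian_loss_quadratic(2))
  then have "AE x in P. direction u x = 0"
    using hessian_loss_quadratic(1) by (subst (asm) integral_nonneg_eq_0_iff_AE) auto
  then have ae: "AE x in lborel_n d. g x = 0"
    unfolding P_def g_def by (subst (asm) AE_density) (auto simp: p_pos)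
  have cont: "continuous_on UNIV g"
    unfolding g_def mixture_direction gauss_def dist_n_power2
    by (intro continuous_intros continuous_on_product_coordinates) auto
  \<comment> \<open>Points of the product space are extensional, so \<open>x\<close> is first
    restricted; \<open>g\<close> reads only its first \<open>d\<close> coordinates.\<close>
  have "g (restrict x {..<d}) = 0"
    by (rule AE_lborel_n_eq_0_imp[OF cont ae]) simp
  moreover have "g (restrict x {..<d}) = g x"
    unfolding g_def mixture_direction gauss_def dist_n_power2 by simp
  ultimately have "g x = 0" by simp
  then show ?thesis unfolding g_def .
qed

text \<open>Both kernels are characterised by \<open>direction u\<close> vanishing: independence of
  the Gaussian scores then kills the averages, and conversely \<open>hessian_loss_apply\<close>
  integrates against \<open>direction u\<close>.\<close>

lemma ker_hessian_eq_ker_avg: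
  assumes "\<forall>k<m. \<forall>l<m. k \<noteq> l \<longrightarrow> (\<exists>c<d. \<mu>s k c \<noteq> \<mu>s l c)"
  shows "ker_map n n d (hessian_map n d (\<lambda>\<nu>. loss d n (mixture d m \<mu>s ws) \<nu> w) \<mu>) =
       ker_map n m d (avg_map m d S w)"
proof -
  have "(\<forall>i<n. \<forall>a<d. (\<Sum>j<n. \<Sum>b<d.
          hessian (\<lambda>\<nu>. loss d n (mixture d m \<mu>s ws) \<nu> w) \<mu> (i, a) (j, b) * u j b) = 0) \<longleftrightarrow>
      (\<forall>l<m. \<forall>a<d. (\<Sum>i\<in>S l. w i * u i a) = 0)" (is "?H \<longleftrightarrow> ?A") for u
  proof
    assume ?H
    then have "mixture d m \<mu>s ws x * direction u x = 0" for x
      by (intro direction_eq_0) auto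
    then show ?A
      unfolding mixture_direction
      using gauss_scores_independent[OF assms, of "\<lambda>l a. \<Sum>i\<in>S l. w i * u i a"] by simp
  next
    assume ?A
    then have "mixture d m \<mu>s ws x * direction u x = 0" for x
      unfolding mixture_direction by simp
    then have "direction u x = 0" for x
      using p_pos by (metis mult_eq_0_iff less_irrefl)
    then show ?H by (simp add: hessian_loss_apply)
  qed
  then show ?thesis
    unfolding ker_map_def hessian_map_def avg_map_def restrict2_eq_0_iff Ball_def lessThan_iff by simp
qed

end

section \<open>Distinct centres from the teacher assumptions, and the conclusion\<close>

text \<open>The first entry of the maximum is positive, so the required distance is positive
  whatever the other two entries are.\<close>

lemma separated_imp_distinct:
  assumes "C0 > 0" "d > 0" "n > 0" "Dmax > 0" "separation_assm C0 d n m \<mu>s ws lmin Dmax"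
    and "k < m" "l < m" "k \<noteq> l"
  shows "\<exists>c<d. \<mu>s k c \<noteq> \<mu>s l c"
proof (rule ccontr)
  assume "\<not> ?thesis"
  then have "dist_n d (\<mu>s k) (\<mu>s l) = 0"
    by (simp add: dist_n_def L2_set_def)
  moreover have "0 < sqrt Dmax * (real d * real n) powr (1 / 4)"
    using assms by simp
  then have "0 < C0 * Max {sqrt Dmax * (real d * real n) powr (1 / 4), s, t}" for s t
    using assms(1) by (auto intro!: mult_pos_pos elim!: less_le_trans intro: Max_ge)
  ultimately show False
    using assms(5-) unfolding separation_assm_def Let_def by (metis not_le)
qed

text \<open>There are \<open>m > 0\<close> nonzero eigenvalues, so
  \<open>lmax \<ge> lmin > 0\<close> and the lower bound on \<open>Dmin\<close> is positive; any one
  centre gives \<open>Dmin \<le> Dmax\<close>.\<close>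

lemma Dmax_pos:
  assumes "m > 0" "d > 0" "n > 0"
    and "spectrum_assm d m \<mu>s ws lmax lmin" "norm_assm d n m \<mu>s lmax lmin Dmax Dmin"
  shows "Dmax > 0"
proof -
  define E where "E = nonzero_eigenvalues (second_moment d m \<mu>s ws)"
  have E: "size E = m" "lmax = Max (set_mset E)" "lmin = Min (set_mset E)" "lmin > 0"
    using assms(4) by (auto simp: spectrum_assm_def E_def Let_def)
  then have "E \<noteq> {#}" using assms(1) by auto
  then have "lmin \<le> lmax"
    unfolding E(2,3) by (intro Max_ge Min_in) auto
  with E(4) assms have "0 < 4 * (lmax / lmin) * sqrt (real d * real n)"
    by simp
  moreover from assms(1,5) have "4 * (lmax / lmin) * sqrt (real d * real n) \<le> Dmin" "Dmin \<le> Dmax"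
    unfolding norm_assm_def by (auto intro: order_trans)
  ultimately show ?thesis by linarith
qed

theorem theoremB5:
  "\<exists>C > 0. \<forall>C0 \<ge> C.
     \<forall>(d::nat) (n::nat) (m::nat) (\<mu>s :: nat \<Rightarrow> nat \<Rightarrow> real) (ws :: nat \<Rightarrow> real)
      (lmax::real) (lmin::real) (Dmax::real) (Dmin::real)
      (\<mu> :: nat \<Rightarrow> nat \<Rightarrow> real) (w :: nat \<Rightarrow> real) (S :: nat \<Rightarrow> nat set).
       \<mu>s \<in> configs m d \<longrightarrow>
       ws \<in> prob_simplex m \<longrightarrow> (\<forall>l<m. ws l > 0) \<longrightarrow>
       spectrum_assm d m \<mu>s ws lmax lmin \<longrightarrow>
       norm_assm d n m \<mu>s lmax lmin Dmax Dmin \<longrightarrow>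
       separation_assm C0 d n m \<mu>s ws lmin Dmax \<longrightarrow>
       \<mu> \<in> configs n d \<longrightarrow>
       w \<in> prob_simplex n \<longrightarrow> (\<forall>i<n. w i > 0) \<longrightarrow>
       exact_clustering n m \<mu>s ws S \<mu> w \<longrightarrow>
       ker_map n n d (hessian_map n d (\<lambda>\<nu>. loss d n (mixture d m \<mu>s ws) \<nu> w) \<mu>) =
       ker_map n m d (avg_map m d S w)"
proof (rule exI[of _ 1], intro conjI allI impI)
  fix C0 lmax lmin Dmax Dmin :: real and d n m :: nat
    and \<mu>s \<mu> :: "nat \<Rightarrow> nat \<Rightarrow> real" and ws w :: "nat \<Rightarrow> real" and S :: "nat \<Rightarrow> nat set"
  assume C0: "1 \<le> C0" and ws: "ws \<in> prob_simplex m" "\<forall>l<m. 0 < ws l"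
    and teacher: "spectrum_assm d m \<mu>s ws lmax lmin" "norm_assm d n m \<mu>s lmax lmin Dmax Dmin"
      "separation_assm C0 d n m \<mu>s ws lmin Dmax"
    and w: "w \<in> prob_simplex n" "\<forall>i<n. 0 < w i"
    and clus: "exact_clustering n m \<mu>s ws S \<mu> w"
  \<comment> \<open>An empty weight vector cannot sum to 1.\<close>
  have mn: "m > 0" "n > 0"
    using ws(1) w(1) by (auto simp: prob_simplex_def intro!: gr0I)
  show "ker_map n n d (hessian_map n d (\<lambda>\<nu>. loss d n (mixture d m \<mu>s ws) \<nu> w) \<mu>) =
       ker_map n m d (avg_map m d S w)"
  \<comment> \<open>In dimension 0 all points coincide, but both kernels are then the whole
    configuration space, since there are no coordinates to constrain.\<close>
  proof (cases "d = 0")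
    case True
    then show ?thesis
      unfolding ker_map_def hessian_map_def avg_map_def restrict2_eq_0_iff by simp
  next
    case False
    interpret clustering d n m \<mu>s ws \<mu> w S
      using mn ws w clus by unfold_locales
    have "Dmax > 0"
      using Dmax_pos[OF _ _ _ teacher(1,2)] mn False by simp
    then show ?thesis
      using separated_imp_distinct[OF _ _ _ _ teacher(3)] False C0 mn
      by (intro ker_hessian_eq_ker_avg) auto
  qed
qed simp

end
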